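(* Let $D\geq 0$, let $r_0,r_1\in\mathbb{C}^\times$, let $\rho\in\{r_0,r_0^{-1}\}$, $\sigma\in\{r_1,r_1^{-1}\}$, and let $c=(c_0,\dots,c_{D-1})$, $s=(s_0,\dots,s_{D-1})$, $\lambda=(\lambda_0,\dots,\lambda_{D-1})$, $\mu=(\mu_0,\dots,\mu_{D-1})$ be tuples of nonzero complex scalars. Let $O_D$ be a $(2D+1)$-dimensional complex vector space with ordered basis $\mathfrak{B}_O=\{a_0,b_0,a_1,b_1,\dots,a_{D-1},b_{D-1},a_D\}$ (and $\mathfrak{B}_O=\{a_0\}$ if $D=0$). Then there exists an $\widetilde{\mathcal H}$-module structure on $O_D$ such that the matrices representing $t_0,u_0,t_1,u_1$ with respect to $\mathfrak{B}_O$ are $T_0,U_0,T_1,U_1$, respectively.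
   Context: For nonzero $r_0,r_1\in\mathbb{C}$, $\widetilde{\mathcal H}=\widetilde{\mathcal H}(r_0,r_1)$ is the unital associative $\mathbb{C}$-algebra generated by $t_0,u_0,t_1,u_1$ subject to the relations (i) $(t_i-r_i)(t_i-r_i^{-1})=0$ for $i\in\{0,1\}$; (ii) $u_0^2=u_0$; (iii) $u_1^2=0$; (iv) $u_0t_0t_1u_1=0=t_1u_1u_0t_0$. For $c,r,s,\lambda,\mu\in\mathbb{C}^{\times}$ put $k(r)=r+r^{-1}$ and $$R(r,\lambda,c)=\begin{pmatrix}k(r)-\lambda^{-1}&-c\lambda^{-1}\\ c^{-1}(\lambda-k(r)+\lambda^{-1})&\lambda^{-1}\end{pmatrix},\quad P(c)=\begin{pmatrix}1&c\\0&0\end{pmatrix},$$ $$S(r,s)=\begin{pmatrix}k(r)&s\\-s^{-1}&0\end{pmatrix},\quad N(s,\mu)=\begin{pmatrix}0&0\\ s^{-1}\mu&0\end{pmatrix}.$$ Matrices act on coordinate column vectors. Define $T_0,U_0,T_1,U_1\in\operatorname{Mat}_{2D+1}(\mathbb{C})$ by $$T_0=\operatorname{blockdiag}(R_0,\dots,R_{D-1},[\rho]),\quad U_0=\operatorname{blockdiag}(P_0,\dots,P_{D-1},[1]),$$ $$T_1=\operatorname{blockdiag}([\sigma],S_0,\dots,S_{D-1}),\quad U_1=\operatorname{blockdiag}([0],N_0,\dots,N_{D-1}),$$ where $R_i=R(r_0,\lambda_i,c_i)$, $P_i=P(c_i)$, $S_i=S(r_1,s_i)$, $N_i=N(s_i,\mu_i)$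 for $0\le i\le D-1$. When $D=0$ all tuples are empty and $T_0=[\rho]$, $U_0=[1]$, $T_1=[\sigma]$, $U_1=[0]$. *)

theory Defs
  imports
    "HOL-Library.Poly_Mapping"
    "HOL-Algebra.Algebraic_Closure_Type"
    "Jordan_Normal_Form.Matrix"
begin

section \<open>Free associative algebras\<close>

text \<open>The free monoid on \<open>'g\<close>, written additively: the convolution product that
  \<^theory>\<open>HOL-Library.Poly_Mapping\<close> puts on finitely supported functions is indexed by an additive
  monoid. So \<open>'g free_monoid \<Rightarrow>\<^sub>0 complex\<close> is the free unital associative complex algebra
  on \<open>'g\<close>, with multiplication extending concatenation of words.\<close>

datatype 'g free_monoid = Word (letters: "'g list")

instantiation free_monoid :: (type) monoid_add
begin

definition zero_free_monoid :: "'a free_monoid"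
  where "0 = Word []"

definition plus_free_monoid :: "'a free_monoid \<Rightarrow> 'a free_monoid \<Rightarrow> 'a free_monoid"
  where "v + w = Word (letters v @ letters w)"

instance
  by standard (simp_all add: zero_free_monoid_def plus_free_monoid_def)

end

type_synonym 'g free_algebra = "'g free_monoid \<Rightarrow>\<^sub>0 complex"

definition gen :: "'g \<Rightarrow> 'g free_algebra"
  where "gen g = Poly_Mapping.single (Word [g]) 1"

definition scalar :: "complex \<Rightarrow> 'g free_algebra"
  where "scalar z = Poly_Mapping.single 0 z"

section \<open>The algebra \<open>\<H>(r\<^sub>0, r\<^sub>1)\<close>\<close>

datatype generator = t0 | u0 | t1 | u1

definition H_relations :: "complex \<Rightarrow> complex \<Rightarrow> generator free_algebra set"
  where "H_relations r0 r1 =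
    {(gen t0 - scalar r0) * (gen t0 - scalar (inverse r0)),
     (gen t1 - scalar r1) * (gen t1 - scalar (inverse r1)),
     gen u0 ^ 2 - gen u0,
     gen u1 ^ 2,
     gen u0 * gen t0 * gen t1 * gen u1,
     gen t1 * gen u1 * gen u0 * gen t0}"

text \<open>In HOL-Algebra \<open>ideal\<close>, and hence \<^const>\<open>genideal\<close>, is two-sided.\<close>

definition H_ideal :: "complex \<Rightarrow> complex \<Rightarrow> generator free_algebra set"
  where "H_ideal r0 r1 = genideal ring_of_type_algebra (H_relations r0 r1)"

definition H_algebra :: "complex \<Rightarrow> complex \<Rightarrow> generator free_algebra set ring"
  where "H_algebra r0 r1 = ring_of_type_algebra Quot H_ideal r0 r1"

definition H_class :: "complex \<Rightarrow> complex \<Rightarrow> generator free_algebra \<Rightarrow> generator free_algebra set"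
  where "H_class r0 r1 x = H_ideal r0 r1 +>\<^bsub>ring_of_type_algebra\<^esub> x"

abbreviation H_gen :: "complex \<Rightarrow> complex \<Rightarrow> generator \<Rightarrow> generator free_algebra set"
  where "H_gen r0 r1 g \<equiv> H_class r0 r1 (gen g)"

abbreviation H_scalar :: "complex \<Rightarrow> complex \<Rightarrow> complex \<Rightarrow> generator free_algebra set"
  where "H_scalar r0 r1 z \<equiv> H_class r0 r1 (scalar z)"

lemma ring_of_type_algebra_noncomm: "ring (ring_of_type_algebra :: 'a::ring_1 ring)"
proof -
  have "\<exists>y. x + y = 0" for x :: 'a
    using add.right_inverse by blast
  then show ?thesis
    unfolding ring_of_type_algebra_def using add.right_inverse
    by unfold_locales (auto simp: algebra_simps Units_def)
qed

lemma ideal_H_ideal: "ideal (H_ideal r0 r1) ring_of_type_algebra"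
  unfolding H_ideal_def
  by (rule ring.genideal_ideal[OF ring_of_type_algebra_noncomm])
    (simp add: ring_of_type_algebra_def)

lemma ring_H_algebra: "ring (H_algebra r0 r1)"
  unfolding H_algebra_def by (rule ideal.quotient_is_ring[OF ideal_H_ideal])

section \<open>Modules over a complex algebra\<close>

text \<open>A unital left module structure \<open>act\<close>, over a complex algebra given as a ring \<open>A\<close> with
  structure map \<open>\<iota>\<close>, on the complex vector space of all elements of type \<open>'v\<close> with scalar
  multiplication \<open>scale\<close>. The last axiom says that the action extends the given vector space
  structure; thus every \<open>act x\<close> is complex linear.\<close>

locale algebra_module = ring A + V: vector_space scale
  for A :: "('r, 'm) ring_scheme" (structure)
    and \<iota> :: "complex \<Rightarrow> 'r"
    and scale :: "complex \<Rightarrow> 'v::ab_group_add \<Rightarrow> 'v"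
    and act :: "'r \<Rightarrow> 'v \<Rightarrow> 'v" +
  assumes act_add_right: "x \<in> carrier A \<Longrightarrow> act x (v + w) = act x v + act x w"
    and act_add_left: "x \<in> carrier A \<Longrightarrow> y \<in> carrier A \<Longrightarrow> act (x \<oplus> y) v = act x v + act y v"
    and act_mult: "x \<in> carrier A \<Longrightarrow> y \<in> carrier A \<Longrightarrow> act (x \<otimes> y) v = act x (act y v)"
    and act_one: "act \<one> v = v"
    and act_scalar: "act (\<iota> z) v = scale z v"

definition H_module ::
  "complex \<Rightarrow> complex \<Rightarrow> (complex \<Rightarrow> 'v::ab_group_add \<Rightarrow> 'v) \<Rightarrow>
   (generator free_algebra set \<Rightarrow> 'v \<Rightarrow> 'v) \<Rightarrow> bool"
  where "H_module r0 r1 scale act \<longleftrightarrow>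
    algebra_module (H_algebra r0 r1) (H_scalar r0 r1) scale act"

section \<open>Ordered bases and representing matrices\<close>

definition ordered_basis :: "(complex \<Rightarrow> 'v::ab_group_add \<Rightarrow> 'v) \<Rightarrow> 'v list \<Rightarrow> bool"
  where "ordered_basis scale B \<longleftrightarrow>
    distinct B \<and> \<not> module.dependent scale (set B) \<and> module.span scale (set B) = UNIV"

text \<open>Matrices act on coordinate columns: column \<open>j\<close> holds the coordinates of the image of the
  \<open>j\<close>-th basis vector.\<close>

definition matrix_wrt ::
  "(complex \<Rightarrow> 'v::ab_group_add \<Rightarrow> 'v) \<Rightarrow> 'v list \<Rightarrow> ('v \<Rightarrow> 'v) \<Rightarrow> complex mat"
  where "matrix_wrt scale B f =
    mat (length B) (length B) (\<lambda>(i, j). module.representation scale (set B) (f (B ! j)) (B ! i))"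

definition O_basis :: "nat \<Rightarrow> (nat \<Rightarrow> 'v) \<Rightarrow> (nat \<Rightarrow> 'v) \<Rightarrow> 'v list"
  where "O_basis D a b = concat (map (\<lambda>i. [a i, b i]) [0..<D]) @ [a D]"

section \<open>The matrices\<close>

definition k :: "complex \<Rightarrow> complex"
  where "k r = r + inverse r"

definition R_block :: "complex \<Rightarrow> complex \<Rightarrow> complex \<Rightarrow> complex mat"
  where "R_block r l c = mat_of_rows_list 2
    [[k r - inverse l, - c * inverse l],
     [inverse c * (l - k r + inverse l), inverse l]]"

definition P_block :: "complex \<Rightarrow> complex mat"
  where "P_block c = mat_of_rows_list 2 [[1, c], [0, 0]]"

definition S_block :: "complex \<Rightarrow> complex \<Rightarrow> complex mat"
  where "S_block r s = mat_of_rows_list 2 [[k r, s], [- inverse s, 0]]"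

definition N_block :: "complex \<Rightarrow> complex \<Rightarrow> complex mat"
  where "N_block s m = mat_of_rows_list 2 [[0, 0], [inverse s * m, 0]]"

definition single_block :: "complex \<Rightarrow> complex mat"
  where "single_block z = mat_of_rows_list 1 [[z]]"

text \<open>The tuples are functions on \<open>nat\<close>, of which only the values at \<open>i < D\<close> are used.\<close>

definition T0_mat :: "nat \<Rightarrow> complex \<Rightarrow> complex \<Rightarrow> (nat \<Rightarrow> complex) \<Rightarrow> (nat \<Rightarrow> complex) \<Rightarrow> complex mat"
  where "T0_mat D r0 \<rho> l c =
    diag_block_mat (map (\<lambda>i. R_block r0 (l i) (c i)) [0..<D] @ [single_block \<rho>])"

definition U0_mat :: "nat \<Rightarrow> (nat \<Rightarrow> complex) \<Rightarrow> complex mat"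
  where "U0_mat D c = diag_block_mat (map (\<lambda>i. P_block (c i)) [0..<D] @ [single_block 1])"

definition T1_mat :: "nat \<Rightarrow> complex \<Rightarrow> complex \<Rightarrow> (nat \<Rightarrow> complex) \<Rightarrow> complex mat"
  where "T1_mat D r1 \<sigma> s =
    diag_block_mat (single_block \<sigma> # map (\<lambda>i. S_block r1 (s i)) [0..<D])"

definition U1_mat :: "nat \<Rightarrow> (nat \<Rightarrow> complex) \<Rightarrow> (nat \<Rightarrow> complex) \<Rightarrow> complex mat"
  where "U1_mat D s m =
    diag_block_mat (single_block 0 # map (\<lambda>i. N_block (s i) (m i)) [0..<D])"

end

theory Submission
  imports Defs
begin

text \<open>
  A module over \<open>\<H>(r\<^sub>0, r\<^sub>1)\<close> is a choice of four linear operators satisfying the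
  defining relations: operators extend from the generators to the free algebra by evaluation, and
  the two-sided ideal of elements that evaluate to zero contains the ideal generated by the
  relations, so that evaluation descends to the quotient (\<open>H_module_from_operators\<close>). Relative to
  an ordered basis, operators are matrices and composition is matrix multiplication
  (\<open>H_module_from_matrices\<close>). What remains are the six relations for the matrices
  \<open>T\<^sub>0, U\<^sub>0, T\<^sub>1, U\<^sub>1\<close>.

  The relations in a single generator can be checked block by block, because each of them has the
  form \<open>A\<^sup>2 = p A + q\<close> with scalars \<open>p\<close> and \<open>q\<close>: for the generators \<open>t\<^sub>i\<close> it reads
  \<open>A\<^sup>2 = k(r\<^sub>i) A - 1\<close>. For a two by two block this is the Cayley-Hamilton identity, so it is
  enough to read off trace and determinant: \<open>R\<close> and \<open>S\<close> have trace \<open>k(r)\<close> and determinant 1,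
  \<open>P\<close> has trace 1 and determinant 0, and \<open>N\<close> has trace and determinant 0.

  The two relations mixing both pairs of generators are less local, since the blocks of
  \<open>T\<^sub>0, U\<^sub>0\<close> and those of \<open>T\<^sub>1, U\<^sub>1\<close> are staggered: the former join \<open>a\<^sub>i\<close> to \<open>b\<^sub>i\<close>, the
  latter \<open>b\<^sub>i\<close> to \<open>a\<^sub>i\<^sub>+\<^sub>1\<close>. However, \<open>P R = diag(\<lambda>, 0)\<close> and \<open>S N = diag(\<mu>, 0)\<close>. Thus
  \<open>U\<^sub>0 T\<^sub>0\<close> is diagonal and supported on the vectors \<open>a\<^sub>i\<close>, while \<open>T\<^sub>1 U\<^sub>1\<close> is diagonal and
  supported on the vectors \<open>b\<^sub>i\<close>. Diagonal matrices with disjoint supports annihilate each other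
  in either order.
\<close>

section \<open>Evaluating the free algebra at linear operators\<close>

text \<open>Additive statements need only be checked on monomials.\<close>

lemma poly_mapping_additive_induct [case_names single add]:
  fixes x :: "'a \<Rightarrow>\<^sub>0 'b::comm_monoid_add"
  assumes single: "\<And>w z. P (Poly_Mapping.single w z)"
    and add: "\<And>x y. P x \<Longrightarrow> P y \<Longrightarrow> P (x + y)"
  shows "P x"
proof (induction x rule: update_induct)
  case const
  show ?case using single[of undefined 0] by simp
next
  case (update x w z)
  have "Poly_Mapping.update w z x = x + Poly_Mapping.single w z"
    using update by (intro poly_mapping_eqI) (auto simp: lookup_update lookup_add lookup_single when_def in_keys_iff)
  then show ?case using update single add by metis
qed

locale linear_operators = V: vector_space scale
  for scale :: "complex \<Rightarrow> 'v::ab_group_add \<Rightarrow> 'v" +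
  fixes f :: "'g \<Rightarrow> 'v \<Rightarrow> 'v"
  assumes f_add: "f g (v + w) = f g v + f g w"
    and f_scale: "f g (scale z v) = scale z (f g v)"
begin

definition word_action :: "'g free_monoid \<Rightarrow> 'v \<Rightarrow> 'v"
  where "word_action w = foldr f (letters w)"

definition evaluate :: "'g free_algebra \<Rightarrow> 'v \<Rightarrow> 'v"
  where "evaluate x v = (\<Sum>w\<in>Poly_Mapping.keys x. scale (Poly_Mapping.lookup x w) (word_action w v))"

lemma f_diff: "f g (v - w) = f g v - f g w"
  using f_add[of g "v - w" w] by (simp add: algebra_simps)

lemma word_action_append: "word_action (w + w') v = word_action w (word_action w' v)"
  by (simp add: word_action_def plus_free_monoid_def)

lemma word_action_zero: "word_action 0 v = v"
  by (simp add: word_action_def zero_free_monoid_def)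

lemma word_action_add: "word_action w (v + v') = word_action w v + word_action w v'"
proof -
  have "foldr f gs (v + v') = foldr f gs v + foldr f gs v'" for gs
    by (induction gs) (simp_all add: f_add)
  then show ?thesis by (simp add: word_action_def)
qed

lemma word_action_scale: "word_action w (scale z v) = scale z (word_action w v)"
proof -
  have "foldr f gs (scale z v) = scale z (foldr f gs v)" for gs
    by (induction gs) (simp_all add: f_scale)
  then show ?thesis by (simp add: word_action_def)
qed

lemma evaluate_superset:
  assumes "finite S" "Poly_Mapping.keys x \<subseteq> S"
  shows "evaluate x v = (\<Sum>w\<in>S. scale (Poly_Mapping.lookup x w) (word_action w v))"
  unfolding evaluate_def using assms
  by (intro sum.mono_neutral_left) (auto simp: in_keys_iff)

lemma evaluate_add: "evaluate (x + y) v = evaluate x v + evaluate y v"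
proof -
  let ?S = "Poly_Mapping.keys x \<union> Poly_Mapping.keys y"
  have "Poly_Mapping.keys (x + y) \<subseteq> ?S" by (rule keys_add)
  then show ?thesis
    by (simp add: evaluate_superset[of ?S] lookup_add V.scale_left_distrib sum.distrib)
qed

lemma evaluate_diff: "evaluate (x - y) v = evaluate x v - evaluate y v"
  using evaluate_add[of "x - y" y v] by (simp add: algebra_simps)

lemma evaluate_single: "evaluate (Poly_Mapping.single w z) v = scale z (word_action w v)"
  by (simp add: evaluate_superset[of "{w}"])

lemma evaluate_zero [simp]: "evaluate 0 v = 0"
  by (simp add: evaluate_def)

lemma evaluate_scalar [simp]: "evaluate (scalar z) v = scale z v"
  by (simp add: scalar_def evaluate_single word_action_zero)

lemma evaluate_one [simp]: "evaluate 1 v = v"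
  using evaluate_scalar[of 1 v] by (simp add: scalar_def single_one del: evaluate_scalar)

lemma evaluate_gen [simp]: "evaluate (gen g) v = f g v"
  by (simp add: gen_def evaluate_single word_action_def)

lemma evaluate_add_right: "evaluate x (v + w) = evaluate x v + evaluate x w"
  by (simp add: evaluate_def word_action_add V.scale_right_distrib sum.distrib)

lemma evaluate_scale_right: "evaluate x (scale z v) = scale z (evaluate x v)"
  by (simp add: evaluate_def word_action_scale V.scale_sum_right mult.commute)

lemma evaluate_zero_right [simp]: "evaluate x 0 = 0"
  using evaluate_scale_right[of x 0 0] by simp

text \<open>Both sides are biadditive in \<open>x\<close> and \<open>y\<close>, and for single words the claim says that
  concatenation acts as composition.\<close>

lemma evaluate_mult: "evaluate (x * y) v = evaluate x (evaluate y v)"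
proof (induction x rule: poly_mapping_additive_induct)
  case (single w z)
  show ?case
  proof (induction y rule: poly_mapping_additive_induct)
    case (single w' z')
    show ?case
      by (simp add: mult_single evaluate_single word_action_append word_action_scale)
  next
    case (add y y')
    then show ?case by (simp add: distrib_left evaluate_add evaluate_add_right)
  qed
next
  case (add x x')
  then show ?case by (simp add: distrib_right evaluate_add)
qed

lemma ideal_kernel_evaluate: "ideal {x. \<forall>v. evaluate x v = 0} ring_of_type_algebra"
proof (rule idealI[OF ring_of_type_algebra_noncomm])
  interpret R: ring "ring_of_type_algebra :: 'g free_algebra ring"
    by (rule ring_of_type_algebra_noncomm)
  have inv: "inv\<^bsub>add_monoid ring_of_type_algebra\<^esub> x = - x" for x :: "'g free_algebra"
    unfolding a_inv_def[symmetric]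
    by (rule R.minus_equality) (simp_all add: ring_of_type_algebra_def)
  show "subgroup {x. \<forall>v. evaluate x v = 0} (add_monoid ring_of_type_algebra)"
  proof
    fix x assume "x \<in> {x. \<forall>v. evaluate x v = 0}"
    then show "inv\<^bsub>add_monoid ring_of_type_algebra\<^esub> x \<in> {x. \<forall>v. evaluate x v = 0}"
      unfolding inv using evaluate_diff[of 0 x] by simp
  qed (auto simp: ring_of_type_algebra_def evaluate_add)
qed (auto simp: ring_of_type_algebra_def evaluate_mult)

end

section \<open>Modules over \<open>\<H>(r\<^sub>0, r\<^sub>1)\<close> from operators satisfying the relations\<close>

text \<open>The universal property of a presentation. An element of the quotient acts through any
  representative, which is independent of the choice because the ideal acts as zero.\<close>

lemma H_module_from_operators:
  fixes scale :: "complex \<Rightarrow> 'v::ab_group_add \<Rightarrow> 'v" and f :: "generator \<Rightarrow> 'v \<Rightarrow> 'v"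
  assumes "linear_operators scale f"
    and relations: "\<And>x v. x \<in> H_relations r0 r1 \<Longrightarrow> linear_operators.evaluate scale f x v = 0"
  shows "\<exists>act. H_module r0 r1 scale act \<and> (\<forall>g. act (H_gen r0 r1 g) = f g)"
proof -
  interpret linear_operators scale f by fact
  let ?R = "ring_of_type_algebra :: generator free_algebra ring"
  interpret I: ideal "H_ideal r0 r1" ?R by (rule ideal_H_ideal)
  interpret A: ring "H_algebra r0 r1" by (rule ring_H_algebra)
  have kernel: "H_ideal r0 r1 \<subseteq> {x. \<forall>v. evaluate x v = 0}"
    unfolding H_ideal_def
    by (rule I.genideal_minimal[OF ideal_kernel_evaluate]) (use relations in auto)
  have R [simp]: "x \<in> carrier ?R" "x \<oplus>\<^bsub>?R\<^esub> y = x + y" "x \<otimes>\<^bsub>?R\<^esub> y = x * y" "\<one>\<^bsub>?R\<^esub> = 1" for x y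
    by (simp_all add: ring_of_type_algebra_def)
  have minus: "x \<ominus>\<^bsub>?R\<^esub> y = x - y" for x y
    by (metis I.add.inv_solve_right R(1,2) a_minus_def diff_add_cancel)
  define act where "act p = evaluate (SOME x. p = H_class r0 r1 x)" for p
  have act: "act (H_class r0 r1 x) = evaluate x" for x
  proof
    fix v
    define y where "y = (SOME y. H_class r0 r1 x = H_class r0 r1 y)"
    have "H_class r0 r1 x = H_class r0 r1 y"
      unfolding y_def by (rule someI) (rule refl)
    then have "x \<ominus>\<^bsub>?R\<^esub> y \<in> H_ideal r0 r1"
      using I.quotient_eq_iff_same_a_r_cos[OF ideal_H_ideal, of x y] by (simp add: H_class_def)
    then have "evaluate (x - y) v = 0" using kernel by (auto simp: minus)
    then show "act (H_class r0 r1 x) v = evaluate x v"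
      by (simp add: act_def y_def[symmetric] evaluate_diff)
  qed
  have carrier: "\<exists>x. p = H_class r0 r1 x" if "p \<in> carrier (H_algebra r0 r1)" for p
    using that
    by (auto simp: H_algebra_def FactRing_def A_RCOSETS_def RCOSETS_def H_class_def a_r_coset_def)
  have plus: "H_class r0 r1 x \<oplus>\<^bsub>H_algebra r0 r1\<^esub> H_class r0 r1 y = H_class r0 r1 (x + y)" for x y
    using I.a_rcos_sum[of x y] by (simp add: H_algebra_def FactRing_def H_class_def)
  have times: "H_class r0 r1 x \<otimes>\<^bsub>H_algebra r0 r1\<^esub> H_class r0 r1 y = H_class r0 r1 (x * y)" for x y
    using I.rcoset_mult_add[of x y] by (simp add: H_algebra_def FactRing_def H_class_def)
  have one: "\<one>\<^bsub>H_algebra r0 r1\<^esub> = H_class r0 r1 1"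
    by (simp add: H_algebra_def FactRing_def H_class_def)
  have "H_module r0 r1 scale act"
    unfolding H_module_def
  proof unfold_locales
    fix p q v w assume "p \<in> carrier (H_algebra r0 r1)" "q \<in> carrier (H_algebra r0 r1)"
    then obtain x y where "p = H_class r0 r1 x" "q = H_class r0 r1 y"
      using carrier by metis
    then show "act (p \<oplus>\<^bsub>H_algebra r0 r1\<^esub> q) v = act p v + act q v"
      and "act (p \<otimes>\<^bsub>H_algebra r0 r1\<^esub> q) v = act p (act q v)"
      by (simp_all add: plus times act evaluate_add evaluate_mult)
  next
    fix p v w assume "p \<in> carrier (H_algebra r0 r1)"
    then show "act p (v + w) = act p v + act p w"
      using carrier[of p] by (auto simp: act evaluate_add_right)
  qed (simp_all add: one act)
  then show ?thesis by (intro exI[of _ act]) (auto simp: act)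
qed

section \<open>Operators with prescribed matrices\<close>

locale finite_basis = vector_space scale
  for scale :: "complex \<Rightarrow> 'v::ab_group_add \<Rightarrow> 'v" +
  fixes B :: "'v list"
  assumes basis: "ordered_basis scale B"
begin

definition coord :: "nat \<Rightarrow> 'v \<Rightarrow> complex"
  where "coord i v = representation (set B) v (B ! i)"

definition operator_of :: "complex mat \<Rightarrow> 'v \<Rightarrow> 'v"
  where "operator_of A v =
    (\<Sum>i<length B. scale (\<Sum>j<length B. A $$ (i, j) * coord j v) (B ! i))"

lemma
  shows distinct_basis: "distinct B"
    and independent_basis: "independent (set B)"
    and in_span_basis: "v \<in> span (set B)"
  using basis by (auto simp: ordered_basis_def)

lemma coord_add: "coord i (v + w) = coord i v + coord i w"
  by (simp add: coord_def representation_add independent_basis in_span_basis)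

lemma coord_scale: "coord i (scale z v) = z * coord i v"
  by (simp add: coord_def representation_scale independent_basis in_span_basis)

lemma coord_sum: "coord i (\<Sum>x\<in>S. g x) = (\<Sum>x\<in>S. coord i (g x))"
  by (simp add: coord_def representation_sum independent_basis in_span_basis)

lemma coord_basis:
  assumes "i < length B" "j < length B"
  shows "coord i (B ! j) = (if i = j then 1 else 0)"
  using assms distinct_basis
  by (auto simp: coord_def representation_basis independent_basis nth_eq_iff_index_eq)

lemma coord_eqI:
  assumes "\<And>i. i < length B \<Longrightarrow> coord i v = coord i w"
  shows "v = w"
proof -
  have rep: "(\<Sum>b\<in>set B. scale (representation (set B) u b) b) = u" for u
    by (rule sum_representation_eq) (simp_all add: independent_basis in_span_basis)
  have "(\<Sum>b\<in>set B. scale (representation (set B) v b) b) =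
      (\<Sum>b\<in>set B. scale (representation (set B) w b) b)"
    by (rule sum.cong) (use assms in \<open>auto simp: coord_def in_set_conv_nth\<close>)
  then show ?thesis by (simp add: rep)
qed

lemma coord_operator_of:
  assumes "i < length B"
  shows "coord i (operator_of A v) = (\<Sum>j<length B. A $$ (i, j) * coord j v)"
  using assms by (simp add: operator_of_def coord_sum coord_scale coord_basis if_distrib cong: if_cong)

lemma operator_of_add: "operator_of A (v + w) = operator_of A v + operator_of A w"
  by (rule coord_eqI) (simp add: coord_operator_of coord_add distrib_left sum.distrib)

lemma operator_of_scale: "operator_of A (scale z v) = scale z (operator_of A v)"
  by (rule coord_eqI) (simp add: coord_operator_of coord_scale sum_distrib_left mult.left_commute)

lemma operator_of_mult:
  assumes "A \<in> carrier_mat (length B) (length B)" "A' \<in> carrier_mat (length B) (length B)"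
  shows "operator_of (A * A') v = operator_of A (operator_of A' v)"
proof (rule coord_eqI)
  fix i assume i: "i < length B"
  have "coord i (operator_of (A * A') v) =
      (\<Sum>k<length B. (\<Sum>j<length B. A $$ (i, j) * A' $$ (j, k)) * coord k v)"
    using i assms by (simp add: coord_operator_of scalar_prod_def lessThan_atLeast0)
  also have "\<dots> = (\<Sum>j<length B. A $$ (i, j) * (\<Sum>k<length B. A' $$ (j, k) * coord k v))"
    unfolding sum_distrib_left sum_distrib_right mult.assoc by (rule sum.swap)
  also have "\<dots> = coord i (operator_of A (operator_of A' v))"
    using i by (simp add: coord_operator_of)
  finally show "coord i (operator_of (A * A') v) = coord i (operator_of A (operator_of A' v))" .
qed

lemma operator_of_affine:
  assumes "A \<in> carrier_mat (length B) (length B)"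
  shows "operator_of (p \<cdot>\<^sub>m A + q \<cdot>\<^sub>m 1\<^sub>m (length B)) v = scale p (operator_of A v) + scale q v"
proof (rule coord_eqI)
  fix i assume i: "i < length B"
  have "coord i (operator_of (p \<cdot>\<^sub>m A + q \<cdot>\<^sub>m 1\<^sub>m (length B)) v) =
      (\<Sum>j<length B. p * (A $$ (i, j) * coord j v) + (if i = j then q * coord j v else 0))"
    unfolding coord_operator_of[OF i]
    by (intro sum.cong refl) (use i assms in \<open>auto simp: distrib_right\<close>)
  also have "\<dots> = coord i (scale p (operator_of A v) + scale q v)"
    using i by (simp add: coord_add coord_scale coord_operator_of sum.distrib sum_distrib_left)
  finally show "coord i (operator_of (p \<cdot>\<^sub>m A + q \<cdot>\<^sub>m 1\<^sub>m (length B)) v) =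
      coord i (scale p (operator_of A v) + scale q v)" .
qed

lemma operator_of_zero: "operator_of (0\<^sub>m (length B) (length B)) v = 0"
  by (simp add: operator_of_def)

lemma matrix_wrt_operator_of:
  assumes "A \<in> carrier_mat (length B) (length B)"
  shows "matrix_wrt scale B (operator_of A) = A"
proof (rule eq_matI)
  fix i j assume "i < dim_row A" "j < dim_col A"
  then have ij: "i < length B" "j < length B" using assms by auto
  have "matrix_wrt scale B (operator_of A) $$ (i, j) = coord i (operator_of A (B ! j))"
    using ij by (simp add: matrix_wrt_def coord_def)
  also have "\<dots> = A $$ (i, j)"
    using ij by (simp add: coord_operator_of coord_basis if_distrib cong: if_cong)
  finally show "matrix_wrt scale B (operator_of A) $$ (i, j) = A $$ (i, j)" .
qed (use assms in \<open>auto simp: matrix_wrt_def\<close>)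

end

section \<open>Block diagonal matrices\<close>

text \<open>All relations in one generator have this shape, and unlike its factored form
  \<open>(A - x)(A - y) = 0\<close> it carries over to block diagonal matrices without subtracting scalars
  inside the blocks.\<close>

definition satisfies_quadratic :: "complex \<Rightarrow> complex \<Rightarrow> complex mat \<Rightarrow> bool"
  where "satisfies_quadratic p q A \<longleftrightarrow>
    square_mat A \<and> A * A = p \<cdot>\<^sub>m A + q \<cdot>\<^sub>m 1\<^sub>m (dim_row A)"

lemma satisfies_quadratic_diag_block_mat:
  assumes "\<And>A. A \<in> set As \<Longrightarrow> satisfies_quadratic p q A"
  shows "satisfies_quadratic p q (diag_block_mat As)"
  using assms
proof (induction As)
  case Nil
  show ?case by (auto simp: satisfies_quadratic_def intro!: eq_matI)
next
  case (Cons A As)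
  define D where "D = diag_block_mat As"
  define n where "n = dim_row A"
  define d where "d = dim_row D"
  have A: "A \<in> carrier_mat n n" "A * A = p \<cdot>\<^sub>m A + q \<cdot>\<^sub>m 1\<^sub>m n"
    using Cons.prems[of A] by (auto simp: satisfies_quadratic_def n_def)
  have D: "D \<in> carrier_mat d d" "D * D = p \<cdot>\<^sub>m D + q \<cdot>\<^sub>m 1\<^sub>m d"
    using Cons by (auto simp: satisfies_quadratic_def d_def D_def)
  let ?F = "four_block_mat A (0\<^sub>m n d) (0\<^sub>m d n) D"
  have F: "diag_block_mat (A # As) = ?F"
    using A D by (simp add: D_def[symmetric] Let_def)
  have "?F * ?F = four_block_mat (A * A) (0\<^sub>m n d) (0\<^sub>m d n) (D * D)"
    using A(1) D(1) by (subst mult_four_block_mat) auto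
  also have "\<dots> = p \<cdot>\<^sub>m ?F + q \<cdot>\<^sub>m 1\<^sub>m (n + d)"
    unfolding A(2) D(2) using A(1) D(1) by (intro eq_matI) auto
  finally show ?case
    unfolding satisfies_quadratic_def F using A(1) D(1) by simp
qed

lemma diag_block_mat_mult:
  fixes As Bs :: "'a::semiring_1 mat list"
  assumes "list_all2 (\<lambda>A B. square_mat A \<and> square_mat B \<and> dim_row A = dim_row B) As Bs"
  shows "diag_block_mat As * diag_block_mat Bs = diag_block_mat (map2 (*) As Bs)"
  using assms
proof (induction rule: list_all2_induct)
  case Nil
  show ?case by (auto intro!: eq_matI)
next
  case (Cons A As B Bs)
  define n where "n = dim_row A"
  define d where "d = sum_list (map dim_row As)"
  have A: "A \<in> carrier_mat n n" "B \<in> carrier_mat n n"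
    using Cons by (auto simp: n_def)
  have dims: "sum_list (map dim_col As) = d" "sum_list (map dim_col Bs) = d"
      "sum_list (map dim_row Bs) = d"
    using Cons.hyps(2) unfolding d_def by (induction rule: list_all2_induct) auto
  then have D: "diag_block_mat As \<in> carrier_mat d d" "diag_block_mat Bs \<in> carrier_mat d d"
    by (auto simp: dim_diag_block_mat d_def)
  have P: "diag_block_mat (map2 (*) As Bs) \<in> carrier_mat d d"
    unfolding Cons.IH[symmetric] using D by simp
  show ?case
    using A D P by (simp add: Let_def Cons.IH[symmetric]) (subst mult_four_block_mat, auto)
qed

lemma diag_block_mat_concat:
  "diag_block_mat (concat Ass) = diag_block_mat (map diag_block_mat Ass)"
  by (induction Ass) (simp_all add: diag_block_mat_append Let_def)

text \<open>The lists \<open>xs\<close> and \<open>ys\<close> are the diagonals of two diagonal matrices.\<close>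

lemma diag_block_mat_single_blocks_mult_eq_zero:
  assumes "list_all2 (\<lambda>x y. x * y = 0) xs ys"
  shows "diag_block_mat (map single_block xs) * diag_block_mat (map single_block ys) =
    0\<^sub>m (length xs) (length xs)"
proof -
  have zero: "single_block x * single_block y = 0\<^sub>m 1 1" if "x * y = 0" for x y
    using that by (intro eq_matI) (auto simp: single_block_def mat_of_rows_list_def scalar_prod_def)
  have "list_all2 (\<lambda>A B. square_mat A \<and> square_mat B \<and> dim_row A = dim_row B)
      (map single_block xs) (map single_block ys)"
    using assms by (auto simp: list_all2_conv_all_nth single_block_def mat_of_rows_list_def)
  then have "diag_block_mat (map single_block xs) * diag_block_mat (map single_block ys) =
      diag_block_mat (map2 (*) (map single_block xs) (map single_block ys))"
    by (rule diag_block_mat_mult)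
  also have "\<dots> = 0\<^sub>m (length xs) (length xs)"
    using assms
    by (induction rule: list_all2_induct) (simp_all add: zero Let_def)
  finally show ?thesis .
qed

section \<open>The relations for the matrices\<close>

lemma mat_of_rows_list_2_mult:
  fixes a b c d a' b' c' d' :: "'a::semiring_1"
  shows "mat_of_rows_list 2 [[a, b], [c, d]] * mat_of_rows_list 2 [[a', b'], [c', d']] =
    mat_of_rows_list 2 [[a * a' + b * c', a * b' + b * d'], [c * a' + d * c', c * b' + d * d']]"
  by (intro eq_matI)
    (auto simp: mat_of_rows_list_def scalar_prod_def numeral_2_eq_2 less_Suc_eq)

text \<open>The Cayley-Hamilton theorem for two by two matrices.\<close>

lemma satisfies_quadratic_2x2:
  assumes "a + d = p" "a * d - b * c = - q"
  shows "satisfies_quadratic p q (mat_of_rows_list 2 [[a, b], [c, d]])"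
proof -
  have q: "q = b * c - a * d" using assms(2) by (metis minus_diff_eq minus_minus)
  show ?thesis
    unfolding satisfies_quadratic_def mat_of_rows_list_2_mult q assms(1)[symmetric]
    by (intro conjI eq_matI)
      (auto simp: mat_of_rows_list_def numeral_2_eq_2 less_Suc_eq algebra_simps)
qed

lemma satisfies_quadratic_R_block:
  assumes "l \<noteq> 0" "c \<noteq> 0"
  shows "satisfies_quadratic (k r) (-1) (R_block r l c)"
proof -
  have l: "l * inverse l = 1" and c: "c * inverse c = 1"
    using assms by simp_all
  \<comment> \<open>The determinant is 1: the two terms with \<open>k r\<close> cancel, as do the squares of \<open>inverse l\<close>.\<close>
  have "(k r - inverse l) * inverse l - - c * inverse l * (inverse c * (l - k r + inverse l)) =
      k r * inverse l - inverse l * inverse l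
        + (c * inverse c) * (l * inverse l - k r * inverse l + inverse l * inverse l)"
    by (simp add: algebra_simps)
  also have "\<dots> = - (- 1)" by (simp add: l c)
  finally show ?thesis
    unfolding R_block_def by (intro satisfies_quadratic_2x2) simp_all
qed

lemma satisfies_quadratic_S_block:
  assumes "s \<noteq> 0"
  shows "satisfies_quadratic (k r) (-1) (S_block r s)"
  unfolding S_block_def using assms by (intro satisfies_quadratic_2x2) simp_all

lemma satisfies_quadratic_P_block: "satisfies_quadratic 1 0 (P_block c)"
  unfolding P_block_def by (intro satisfies_quadratic_2x2) simp_all

lemma satisfies_quadratic_N_block: "satisfies_quadratic 0 0 (N_block s m)"
  unfolding N_block_def by (intro satisfies_quadratic_2x2) simp_all

lemma satisfies_quadratic_single_block:
  assumes "z * z = p * z + q"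
  shows "satisfies_quadratic p q (single_block z)"
  unfolding satisfies_quadratic_def using assms
  by (auto simp: single_block_def mat_of_rows_list_def scalar_prod_def intro!: eq_matI)

lemma quadratic_root:
  assumes "r \<noteq> 0" "z \<in> {r, inverse r}"
  shows "z * z = k r * z + (- 1)"
  using assms by (auto simp: k_def distrib_right)

lemma diag_block_mat_two_single_blocks:
  "diag_block_mat (map single_block [x, y]) = mat_of_rows_list 2 [[x, 0], [0, y]]"
  by (intro eq_matI)
    (auto simp: single_block_def mat_of_rows_list_def Let_def numeral_2_eq_2 less_Suc_eq)

text \<open>The entries of \<open>R\<close> are such that the row \<open>(1, c)\<close> of \<open>P\<close> is mapped to
  \<open>(l, 0)\<close>: the terms with \<open>k r\<close> and \<open>inverse l\<close> cancel.\<close>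

lemma P_block_mult_R_block:
  assumes "c \<noteq> 0"
  shows "P_block c * R_block r l c = diag_block_mat (map single_block [l, 0])"
proof -
  have "c * (inverse c * z) = z" for z
    using assms by (simp add: mult.assoc[symmetric])
  note cancel = this
  show ?thesis
    by (simp add: cancel P_block_def R_block_def mat_of_rows_list_2_mult diag_block_mat_two_single_blocks
        del: diag_block_mat.simps list.map)
qed

lemma S_block_mult_N_block:
  assumes "s \<noteq> 0"
  shows "S_block r s * N_block s m = diag_block_mat (map single_block [m, 0])"
  using assms
  by (simp add: S_block_def N_block_def mult.assoc[symmetric] mat_of_rows_list_2_mult diag_block_mat_two_single_blocks
      del: diag_block_mat.simps list.map)

lemma single_block_mult: "single_block x * single_block y = single_block (x * y)"
  by (auto simp: single_block_def mat_of_rows_list_def scalar_prod_def intro!: eq_matI)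

lemma dim_blocks [simp]:
  "dim_row (single_block z) = 1" "dim_col (single_block z) = 1"
  "dim_row (R_block r x y) = 2" "dim_col (R_block r x y) = 2"
  "dim_row (P_block y) = 2" "dim_col (P_block y) = 2"
  "dim_row (S_block r y) = 2" "dim_col (S_block r y) = 2"
  "dim_row (N_block x y) = 2" "dim_col (N_block x y) = 2"
  by (simp_all add: single_block_def R_block_def P_block_def S_block_def N_block_def
      mat_of_rows_list_def)

lemma mats_carrier:
  "T0_mat D r0 \<rho> l c \<in> carrier_mat (2 * D + 1) (2 * D + 1)"
  "U0_mat D c \<in> carrier_mat (2 * D + 1) (2 * D + 1)"
  "T1_mat D r1 \<sigma> s \<in> carrier_mat (2 * D + 1) (2 * D + 1)"
  "U1_mat D s m \<in> carrier_mat (2 * D + 1) (2 * D + 1)"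
  by (auto simp: T0_mat_def U0_mat_def T1_mat_def U1_mat_def dim_diag_block_mat o_def
      sum_list_triv simp del: diag_block_mat.simps)

text \<open>The next two lemmas cut the products of the blocks further into blocks of size 1. Only in this
  form can the two products be compared, since the blocks of size 2 of one straddle those of the
  other.\<close>

lemma U0_mult_T0:
  assumes "\<And>i. i < D \<Longrightarrow> c i \<noteq> 0"
  shows "U0_mat D c * T0_mat D r0 \<rho> l c =
    diag_block_mat (map single_block (concat (map (\<lambda>i. [l i, 0]) [0..<D]) @ [\<rho>]))"
proof -
  let ?xss = "map (\<lambda>i. [l i, 0]) [0..<D] @ [[\<rho>]]"
  have blocks: "map (\<lambda>i. P_block (c i) * R_block r0 (l i) (c i)) [0..<D] =
      map (\<lambda>i. diag_block_mat (map single_block [l i, 0])) [0..<D]"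
    by (intro map_cong refl P_block_mult_R_block assms) simp
  have "U0_mat D c * T0_mat D r0 \<rho> l c =
      diag_block_mat (map (\<lambda>i. P_block (c i) * R_block r0 (l i) (c i)) [0..<D] @ [single_block \<rho>])"
    unfolding U0_mat_def T0_mat_def
    by (subst diag_block_mat_mult)
      (simp_all add: list_all2_appendI list.rel_map list_all2_same zip_map_map single_block_mult
        zip_same_conv_map o_def del: diag_block_mat.simps)
  also have "\<dots> = diag_block_mat (map diag_block_mat (map (map single_block) ?xss))"
    by (simp add: blocks o_def del: diag_block_mat.simps)
  also have "\<dots> = diag_block_mat (map single_block (concat ?xss))"
    by (simp only: diag_block_mat_concat[symmetric] map_concat)
  finally show ?thesis by simp
qed

lemma T1_mult_U1:
  assumes "\<And>i. i < D \<Longrightarrow> s i \<noteq> 0"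
  shows "T1_mat D r1 \<sigma> s * U1_mat D s m =
    diag_block_mat (map single_block (0 # concat (map (\<lambda>i. [m i, 0]) [0..<D])))"
proof -
  let ?yss = "[0] # map (\<lambda>i. [m i, 0]) [0..<D]"
  have blocks: "map (\<lambda>i. S_block r1 (s i) * N_block (s i) (m i)) [0..<D] =
      map (\<lambda>i. diag_block_mat (map single_block [m i, 0])) [0..<D]"
    by (intro map_cong refl S_block_mult_N_block assms) simp
  have "T1_mat D r1 \<sigma> s * U1_mat D s m =
      diag_block_mat (single_block 0 # map (\<lambda>i. S_block r1 (s i) * N_block (s i) (m i)) [0..<D])"
    unfolding T1_mat_def U1_mat_def
    by (subst diag_block_mat_mult)
      (simp_all add: list.rel_map list_all2_same zip_map_map single_block_mult
        zip_same_conv_map o_def del: diag_block_mat.simps)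
  also have "\<dots> = diag_block_mat (map diag_block_mat (map (map single_block) ?yss))"
    by (simp add: blocks o_def del: diag_block_mat.simps)
  also have "\<dots> = diag_block_mat (map single_block (concat ?yss))"
    by (simp only: diag_block_mat_concat[symmetric] map_concat)
  finally show ?thesis by simp
qed

text \<open>Moving the block of size 1 from the end to the front shifts the diagonal by one place, so
  that the nonzero entries of one list face the zeros of the other.\<close>

lemma staggered_products_zero:
  fixes l m :: "nat \<Rightarrow> complex"
  shows "list_all2 (\<lambda>x y. x * y = 0)
    (concat (map (\<lambda>i. [l i, 0]) js) @ [\<rho>]) (0 # concat (map (\<lambda>i. [m i, 0]) js))"
  by (induction js) simp_all

lemma mixed_products_zero:
  assumes "\<And>i. i < D \<Longrightarrow> c i \<noteq> 0" "\<And>i. i < D \<Longrightarrow> s i \<noteq> 0"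
  shows "(U0_mat D c * T0_mat D r0 \<rho> l c) * (T1_mat D r1 \<sigma> s * U1_mat D s m) =
      0\<^sub>m (2 * D + 1) (2 * D + 1)"
    and "(T1_mat D r1 \<sigma> s * U1_mat D s m) * (U0_mat D c * T0_mat D r0 \<rho> l c) =
      0\<^sub>m (2 * D + 1) (2 * D + 1)"
proof -
  let ?xs = "concat (map (\<lambda>i. [l i, 0]) [0..<D]) @ [\<rho>]"
  let ?ys = "0 # concat (map (\<lambda>i. [m i, 0]) [0..<D])"
  have len: "length ?xs = 2 * D + 1" "length ?ys = 2 * D + 1"
    by (simp_all add: length_concat o_def sum_list_triv)
  have xy: "list_all2 (\<lambda>x y. x * y = 0) ?xs ?ys"
    by (rule staggered_products_zero)
  then have yx: "list_all2 (\<lambda>x y. x * y = 0) ?ys ?xs"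
    unfolding list_all2_conv_all_nth by (metis mult.commute)
  have U0T0: "U0_mat D c * T0_mat D r0 \<rho> l c = diag_block_mat (map single_block ?xs)"
    by (rule U0_mult_T0) (use assms in auto)
  have T1U1: "T1_mat D r1 \<sigma> s * U1_mat D s m = diag_block_mat (map single_block ?ys)"
    by (rule T1_mult_U1) (use assms in auto)
  show "(U0_mat D c * T0_mat D r0 \<rho> l c) * (T1_mat D r1 \<sigma> s * U1_mat D s m) =
      0\<^sub>m (2 * D + 1) (2 * D + 1)"
    unfolding U0T0 T1U1 diag_block_mat_single_blocks_mult_eq_zero[OF xy] len ..
  show "(T1_mat D r1 \<sigma> s * U1_mat D s m) * (U0_mat D c * T0_mat D r0 \<rho> l c) =
      0\<^sub>m (2 * D + 1) (2 * D + 1)"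
    unfolding U0T0 T1U1 diag_block_mat_single_blocks_mult_eq_zero[OF yx] len ..
qed

section \<open>From matrices to the module\<close>

text \<open>The four-fold products are bracketed in pairs because in the application each pair is one of
  the diagonal matrices above.\<close>

lemma H_module_from_matrices:
  fixes scale :: "complex \<Rightarrow> 'v::ab_group_add \<Rightarrow> 'v" and M :: "generator \<Rightarrow> complex mat"
  assumes "vector_space scale" "ordered_basis scale B" "r0 \<noteq> 0" "r1 \<noteq> 0"
    and M: "\<And>g. M g \<in> carrier_mat (length B) (length B)"
    and t0: "satisfies_quadratic (k r0) (- 1) (M t0)"
    and t1: "satisfies_quadratic (k r1) (- 1) (M t1)"
    and u0: "satisfies_quadratic 1 0 (M u0)"
    and u1: "satisfies_quadratic 0 0 (M u1)"
    and u0t0t1u1: "(M u0 * M t0) * (M t1 * M u1) = 0\<^sub>m (length B) (length B)"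
    and t1u1u0t0: "(M t1 * M u1) * (M u0 * M t0) = 0\<^sub>m (length B) (length B)"
  shows "\<exists>act. H_module r0 r1 scale act \<and>
    (\<forall>g. matrix_wrt scale B (act (H_gen r0 r1 g)) = M g)"
proof -
  interpret finite_basis scale B
    by (intro finite_basis.intro finite_basis_axioms.intro) fact+
  let ?f = "\<lambda>g. operator_of (M g)"
  interpret linear_operators scale ?f
    by unfold_locales (simp_all add: operator_of_add operator_of_scale)
  have quadratic: "?f g (?f g v) = scale p (?f g v) + scale q v"
    if "satisfies_quadratic p q (M g)" for p q g v
    using that operator_of_mult[OF M[of g] M[of g], of v] operator_of_affine[OF M[of g], of p q v] M[of g]
    by (simp add: satisfies_quadratic_def)
  have four: "?f g1 (?f g2 (?f g3 (?f g4 v))) = 0"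
    if "(M g1 * M g2) * (M g3 * M g4) = 0\<^sub>m (length B) (length B)" for g1 g2 g3 g4 v
  proof -
    have "?f g1 (?f g2 (?f g3 (?f g4 v))) = operator_of ((M g1 * M g2) * (M g3 * M g4)) v"
      using M by (simp add: operator_of_mult mult_carrier_mat[OF M M])
    then show ?thesis by (simp add: that operator_of_zero)
  qed
  have root: "evaluate ((gen g - scalar r) * (gen g - scalar (inverse r))) v = 0"
    if "satisfies_quadratic (k r) (- 1) (M g)" "r \<noteq> 0" for g r v
  proof -
    have "evaluate ((gen g - scalar r) * (gen g - scalar (inverse r))) v =
        (?f g (?f g v) - scale (inverse r) (?f g v)) - scale r (?f g v - scale (inverse r) v)"
      by (simp add: evaluate_mult evaluate_diff f_diff f_scale)
    also have "\<dots> = ?f g (?f g v) - scale (k r) (?f g v) + v"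
      using that(2) by (simp add: k_def scale_left_distrib scale_right_diff_distrib)
    finally have "evaluate ((gen g - scalar r) * (gen g - scalar (inverse r))) v =
        ?f g (?f g v) - scale (k r) (?f g v) + v" .
    then show ?thesis using quadratic[OF that(1)] by simp
  qed
  have "evaluate x v = 0" if "x \<in> H_relations r0 r1" for x v
    using that root[OF t0 \<open>r0 \<noteq> 0\<close>] root[OF t1 \<open>r1 \<noteq> 0\<close>]
    by (auto simp: H_relations_def evaluate_mult evaluate_diff power2_eq_square
        quadratic[OF u0] quadratic[OF u1] four[OF u0t0t1u1] four[OF t1u1u0t0])
  then obtain act where "H_module r0 r1 scale act" "\<And>g. act (H_gen r0 r1 g) = ?f g"
    using H_module_from_operators[OF linear_operators_axioms] by blast
  then show ?thesis by (intro exI[of _ act]) (simp add: matrix_wrt_operator_of[OF M])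
qed

theorem proposition3p6:
  fixes D :: nat
    and r0 r1 \<rho> \<sigma> :: complex
    and c s l m :: "nat \<Rightarrow> complex"
    and scale :: "complex \<Rightarrow> 'v::ab_group_add \<Rightarrow> 'v"
    and a b :: "nat \<Rightarrow> 'v"
  assumes "r0 \<noteq> 0" and "r1 \<noteq> 0"
    and "\<rho> \<in> {r0, inverse r0}" and "\<sigma> \<in> {r1, inverse r1}"
    and "\<And>i. i < D \<Longrightarrow> c i \<noteq> 0" and "\<And>i. i < D \<Longrightarrow> s i \<noteq> 0"
    and "\<And>i. i < D \<Longrightarrow> l i \<noteq> 0" and "\<And>i. i < D \<Longrightarrow> m i \<noteq> 0"
    and "vector_space scale"
    and "ordered_basis scale (O_basis D a b)"
  shows "\<exists>act. H_module r0 r1 scale act \<and>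
    matrix_wrt scale (O_basis D a b) (act (H_gen r0 r1 t0)) = T0_mat D r0 \<rho> l c \<and>
    matrix_wrt scale (O_basis D a b) (act (H_gen r0 r1 u0)) = U0_mat D c \<and>
    matrix_wrt scale (O_basis D a b) (act (H_gen r0 r1 t1)) = T1_mat D r1 \<sigma> s \<and>
    matrix_wrt scale (O_basis D a b) (act (H_gen r0 r1 u1)) = U1_mat D s m"
proof -
  define M where "M g = (case g of t0 \<Rightarrow> T0_mat D r0 \<rho> l c | u0 \<Rightarrow> U0_mat D c
    | t1 \<Rightarrow> T1_mat D r1 \<sigma> s | u1 \<Rightarrow> U1_mat D s m)" for g
  have M: "M t0 = T0_mat D r0 \<rho> l c" "M u0 = U0_mat D c" "M t1 = T1_mat D r1 \<sigma> s"
    "M u1 = U1_mat D s m"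
    by (simp_all add: M_def)
  have len: "length (O_basis D a b) = 2 * D + 1"
    by (simp add: O_basis_def length_concat o_def sum_list_triv)
  have "\<exists>act. H_module r0 r1 scale act \<and>
    (\<forall>g. matrix_wrt scale (O_basis D a b) (act (H_gen r0 r1 g)) = M g)"
  proof (rule H_module_from_matrices)
    show "M g \<in> carrier_mat (length (O_basis D a b)) (length (O_basis D a b))" for g
      unfolding len M_def by (cases g) (simp_all only: generator.case mats_carrier)
    show "satisfies_quadratic (k r0) (- 1) (M t0)"
      unfolding M T0_mat_def using assms quadratic_root[of r0 \<rho>]
      by (intro satisfies_quadratic_diag_block_mat)
        (auto intro: satisfies_quadratic_R_block satisfies_quadratic_single_block)
    show "satisfies_quadratic (k r1) (- 1) (M t1)"
      unfolding M T1_mat_def using assms quadratic_root[of r1 \<sigma>]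
      by (intro satisfies_quadratic_diag_block_mat)
        (auto intro: satisfies_quadratic_S_block satisfies_quadratic_single_block)
    show "satisfies_quadratic 1 0 (M u0)"
      unfolding M U0_mat_def
      by (intro satisfies_quadratic_diag_block_mat)
        (auto intro: satisfies_quadratic_P_block satisfies_quadratic_single_block)
    show "satisfies_quadratic 0 0 (M u1)"
      unfolding M U1_mat_def
      by (intro satisfies_quadratic_diag_block_mat)
        (auto intro: satisfies_quadratic_N_block satisfies_quadratic_single_block)
    show "(M u0 * M t0) * (M t1 * M u1) = 0\<^sub>m (length (O_basis D a b)) (length (O_basis D a b))"
      and "(M t1 * M u1) * (M u0 * M t0) = 0\<^sub>m (length (O_basis D a b)) (length (O_basis D a b))"
      unfolding M len by (rule mixed_products_zero; use assms in auto)+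
  qed fact+
  then show ?thesis using M by metis
qed

end
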